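(* Let $T_0$ be a closed, symmetric (densely defined) operator in a complex Hilbert space $H$ with equal, finite deficiency indices $\mathrm{def}(T_0)\ge1$, and let $T_1=T_0^*$ (so $T_1^*=T_0$). Let $W$ be a finite-dimensional complex inner product space with $\dim W\le\mathrm{def}(T_0)$, with orthonormal basis $\{\xi_j\mid j=1,\ldots,\dim W\}$, let $\{t_j\mid j=1,\ldots,\dim W\}\subseteq\mathcal D(T_1)$ be a partial GKN set for $T_0$, and let $B:W\to W$ be self-adjoint. Let $\widehat T_0$ be the operator in $H\oplus W$ with $\mathcal D(\widehat T_0)=\{(x,\Psi x)\mid x\in\Delta_0\}$, $\widehat T_0(x,a)=(T_1x,Ba)$, and let $\widehat T_1$ be the operator in $H\oplus W$ with $\mathcal D(\widehat T_1)=\{(x,a)\mid x\in\mathcal D(T_1),\ a\in W\}$, $\widehat T_1(x,a)=(T_1x,\,Ba-\Omega x)$. Then $$(\widehat T_0)^*=\widehat T_1.$$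
   Context: $\mathrm{def}(T_0)$ is the common value of $\dim\{x\in\mathcal D(T_1)\mid T_1x=\pm ix\}$. $[x,y]_H:=\langle T_1x,y\rangle_H-\langle x,T_1y\rangle_H$ for $x,y\in\mathcal D(T_1)$ (inner products linear in the first argument). A partial GKN set here is a set $\{t_j\mid j=1,\ldots,\dim W\}\subseteq\mathcal D(T_1)$ such that $\sum_j\alpha_jt_j\in\mathcal D(T_0)$ implies all $\alpha_j=0$, and $[t_i,t_j]_H=0$ for all $i,j$. $\Delta_0:=\mathcal D(T_0)+\mathrm{span}\{t_j\mid j=1,\ldots,\dim W\}$; $\Psi:\Delta_0\to W$ is the linear map $\Psi\big(s+\sum_j\alpha_jt_j\big)=\sum_j\alpha_j\xi_j$ for $s\in\mathcal D(T_0)$, $\alpha_j\in\mathbb C$; $\Omega:\mathcal D(T_1)\to W$ is the linear map $\Omega x=\sum_{j=1}^{\dim W}[x,t_j]_H\,\xi_j$. $H\oplus W$ is the Hilbert space of pairs $(x,a)$, $x\in H$, $a\in W$, with $\langle (x,a),(y,b)\rangle_{H\oplus W}=\langle x,y\rangle_H+\langle a,b\rangle_W$. *)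

theory Defs
  imports "HOL-Analysis.Analysis"
begin

section \<open>Complex inner product spaces\<close>

text \<open>HOL-Analysis only provides real inner product spaces. The inner product below is
  linear in the first argument and conjugate-linear in the second.\<close>

class complex_vector = real_vector +
  fixes scaleC :: "complex \<Rightarrow> 'a \<Rightarrow> 'a" (infixr "*\<^sub>C" 75)
  assumes scaleC_add_right: "a *\<^sub>C (x + y) = a *\<^sub>C x + a *\<^sub>C y"
    and scaleC_add_left: "(a + b) *\<^sub>C x = a *\<^sub>C x + b *\<^sub>C x"
    and scaleC_scaleC: "a *\<^sub>C (b *\<^sub>C x) = (a * b) *\<^sub>C x"
    and scaleC_one: "1 *\<^sub>C x = x"
    and scaleR_scaleC: "r *\<^sub>R x = complex_of_real r *\<^sub>C x"

class complex_inner = complex_vector + real_normed_vector +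
  fixes cinner :: "'a \<Rightarrow> 'a \<Rightarrow> complex"
  assumes cinner_commute: "cinner x y = cnj (cinner y x)"
    and cinner_add_left: "cinner (x + y) z = cinner x z + cinner y z"
    and cinner_scaleC_left: "cinner (a *\<^sub>C x) y = a * cinner x y"
    and norm_cinner: "cinner x x = complex_of_real ((norm x)\<^sup>2)"

class chilbert_space = complex_inner + complete_space

global_interpretation complex_vector:
  vector_space "scaleC :: complex \<Rightarrow> 'a \<Rightarrow> 'a :: complex_vector"
  defines cdependent = complex_vector.dependent
    and cspan = complex_vector.span
    and csubspace = complex_vector.subspace
    and cdim = complex_vector.dim
  by unfold_locales (simp_all add: scaleC_add_right scaleC_add_left scaleC_scaleC scaleC_one)

abbreviation clinear :: "('a::complex_vector \<Rightarrow> 'b::complex_vector) \<Rightarrow> bool" where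
  "clinear \<equiv> Vector_Spaces.linear scaleC scaleC"

text \<open>The library dimension of an infinite-dimensional space is 0, so finite dimension is
  stated separately.\<close>

definition cfinite_dim :: "'a::complex_vector set \<Rightarrow> bool" where
  "cfinite_dim V \<longleftrightarrow> (\<exists>S. finite S \<and> V \<subseteq> cspan S)"

text \<open>The direct sum of \<open>H\<close> and \<open>W\<close> is the product type. Its norm and topology are those of
  the library, which agree with the inner product below.\<close>

instantiation prod :: (complex_vector, complex_vector) complex_vector
begin
definition scaleC_prod_def: "a *\<^sub>C p = (a *\<^sub>C fst p, a *\<^sub>C snd p)"
instance
  by standard
    (simp_all add: scaleC_prod_def scaleC_add_right scaleC_add_left scaleC_scaleC scaleC_one
      scaleR_scaleC scaleR_prod_def)
end

instantiation prod :: (complex_inner, complex_inner) complex_inner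
begin
definition cinner_prod_def: "cinner p q = cinner (fst p) (fst q) + cinner (snd p) (snd q)"
instance
proof
  fix x y z :: "'a \<times> 'b" and a :: complex
  show "cinner x y = cnj (cinner y x)"
    unfolding cinner_prod_def
    using cinner_commute[of "fst x" "fst y"] cinner_commute[of "snd x" "snd y"] by simp
  show "cinner (x + y) z = cinner x z + cinner y z"
    by (simp add: cinner_prod_def cinner_add_left)
  show "cinner (a *\<^sub>C x) y = a * cinner x y"
    by (simp add: cinner_prod_def scaleC_prod_def cinner_scaleC_left distrib_left)
  show "cinner x x = complex_of_real ((norm x)\<^sup>2)"
    by (simp add: cinner_prod_def norm_cinner norm_prod_def)
qed
end

instance prod :: (chilbert_space, chilbert_space) chilbert_space ..

definition orthonormal_basis :: "nat \<Rightarrow> (nat \<Rightarrow> 'w::complex_inner) \<Rightarrow> bool" where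
  "orthonormal_basis n \<xi> \<longleftrightarrow>
     (\<forall>i\<in>{1..n}. \<forall>j\<in>{1..n}. cinner (\<xi> i) (\<xi> j) = (if i = j then 1 else 0)) \<and>
     cspan (\<xi> ` {1..n}) = UNIV"


section \<open>Unbounded operators\<close>

text \<open>An operator is a partial function; equality of operators is equality of domains
  together with equality of values.\<close>

type_synonym 'a operator = "'a \<rightharpoonup> 'a"

definition op_app :: "'a operator \<Rightarrow> 'a \<Rightarrow> 'a" (infixr "\<cdot>" 90) where
  "T \<cdot> x = the (T x)"

definition linear_operator :: "'a::complex_vector operator \<Rightarrow> bool" where
  "linear_operator T \<longleftrightarrow> csubspace (dom T) \<and>
     (\<forall>x\<in>dom T. \<forall>y\<in>dom T. T \<cdot> (x + y) = T \<cdot> x + T \<cdot> y) \<and>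
     (\<forall>a. \<forall>x\<in>dom T. T \<cdot> (a *\<^sub>C x) = a *\<^sub>C (T \<cdot> x))"

definition densely_defined :: "'a::complex_inner operator \<Rightarrow> bool" where
  "densely_defined T \<longleftrightarrow> closure (dom T) = UNIV"

definition closed_operator :: "'a::complex_inner operator \<Rightarrow> bool" where
  "closed_operator T \<longleftrightarrow> closed {(x, T \<cdot> x) | x. x \<in> dom T}"

definition symmetric_operator :: "'a::complex_inner operator \<Rightarrow> bool" where
  "symmetric_operator T \<longleftrightarrow> linear_operator T \<and> densely_defined T \<and>
     (\<forall>x\<in>dom T. \<forall>y\<in>dom T. cinner (T \<cdot> x) y = cinner x (T \<cdot> y))"

text \<open>The vector \<open>z\<close> is unique when \<open>T\<close> is densely defined, the only case in which the
  adjoint is meaningful.\<close>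

definition adjoint_op :: "'a::complex_inner operator \<Rightarrow> 'a operator" where
  "adjoint_op T = (\<lambda>y.
     if \<exists>z. \<forall>x\<in>dom T. cinner (T \<cdot> x) y = cinner x z
     then Some (THE z. \<forall>x\<in>dom T. cinner (T \<cdot> x) y = cinner x z)
     else None)"

definition selfadjoint :: "('w::complex_inner \<Rightarrow> 'w) \<Rightarrow> bool" where
  "selfadjoint B \<longleftrightarrow> clinear B \<and> (\<forall>a b. cinner (B a) b = cinner a (B b))"

definition deficiency_space :: "'a::complex_inner operator \<Rightarrow> complex \<Rightarrow> 'a set" where
  "deficiency_space T0 c = {x \<in> dom (adjoint_op T0). adjoint_op T0 \<cdot> x = c *\<^sub>C x}"

definition finite_deficiency_indices :: "'a::complex_inner operator \<Rightarrow> nat \<Rightarrow> bool" where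
  "finite_deficiency_indices T0 d \<longleftrightarrow>
     cfinite_dim (deficiency_space T0 \<i>) \<and> cdim (deficiency_space T0 \<i>) = d \<and>
     cfinite_dim (deficiency_space T0 (-\<i>)) \<and> cdim (deficiency_space T0 (-\<i>)) = d"

definition boundary_form :: "'a::complex_inner operator \<Rightarrow> 'a \<Rightarrow> 'a \<Rightarrow> complex" where
  "boundary_form T1 x y = cinner (T1 \<cdot> x) y - cinner x (T1 \<cdot> y)"

definition partial_GKN_set :: "'a::complex_inner operator \<Rightarrow> nat \<Rightarrow> (nat \<Rightarrow> 'a) \<Rightarrow> bool" where
  "partial_GKN_set T0 n t \<longleftrightarrow>
     (\<forall>j\<in>{1..n}. t j \<in> dom (adjoint_op T0)) \<and>
     (\<forall>\<alpha>. (\<Sum>j=1..n. \<alpha> j *\<^sub>C t j) \<in> dom T0 \<longrightarrow> (\<forall>j\<in>{1..n}. \<alpha> j = 0)) \<and>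
     (\<forall>i\<in>{1..n}. \<forall>j\<in>{1..n}. boundary_form (adjoint_op T0) (t i) (t j) = 0)"


section \<open>The operators on the direct sum\<close>

definition Delta0 :: "'a::complex_inner operator \<Rightarrow> nat \<Rightarrow> (nat \<Rightarrow> 'a) \<Rightarrow> 'a set" where
  "Delta0 T0 n t = {s + u | s u. s \<in> dom T0 \<and> u \<in> cspan (t ` {1..n})}"

text \<open>The value below is unique for \<open>x\<close> in \<open>Delta0 T0 n t\<close> when \<open>t\<close> is a partial GKN set,
  and irrelevant for other \<open>x\<close>.\<close>

definition Psi :: "'h::complex_inner operator \<Rightarrow> nat \<Rightarrow> (nat \<Rightarrow> 'h) \<Rightarrow>
    (nat \<Rightarrow> 'w::complex_inner) \<Rightarrow> 'h \<Rightarrow> 'w" where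
  "Psi T0 n t \<xi> x = (THE w. \<exists>s \<alpha>. s \<in> dom T0 \<and>
     x = s + (\<Sum>j=1..n. \<alpha> j *\<^sub>C t j) \<and> w = (\<Sum>j=1..n. \<alpha> j *\<^sub>C \<xi> j))"

definition Omega :: "'h::complex_inner operator \<Rightarrow> nat \<Rightarrow> (nat \<Rightarrow> 'h) \<Rightarrow>
    (nat \<Rightarrow> 'w::complex_inner) \<Rightarrow> 'h \<Rightarrow> 'w" where
  "Omega T1 n t \<xi> x = (\<Sum>j=1..n. boundary_form T1 x (t j) *\<^sub>C \<xi> j)"

definition hatT0 :: "'h::complex_inner operator \<Rightarrow> nat \<Rightarrow> (nat \<Rightarrow> 'h) \<Rightarrow>
    (nat \<Rightarrow> 'w::complex_inner) \<Rightarrow> ('w \<Rightarrow> 'w) \<Rightarrow> ('h \<times> 'w) operator" where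
  "hatT0 T0 n t \<xi> B = (\<lambda>(x, a).
     if x \<in> Delta0 T0 n t \<and> a = Psi T0 n t \<xi> x
     then Some (adjoint_op T0 \<cdot> x, B a) else None)"

definition hatT1 :: "'h::complex_inner operator \<Rightarrow> nat \<Rightarrow> (nat \<Rightarrow> 'h) \<Rightarrow>
    (nat \<Rightarrow> 'w::complex_inner) \<Rightarrow> ('w \<Rightarrow> 'w) \<Rightarrow> ('h \<times> 'w) operator" where
  "hatT1 T1 n t \<xi> B = (\<lambda>(x, a).
     if x \<in> dom T1 then Some (T1 \<cdot> x, B a - Omega T1 n t \<xi> x) else None)"

end

theory Submission
  imports Defs
begin

text \<open>The boundary form \<open>[s, y]\<close> vanishes for \<open>s\<close> in \<open>D(T0)\<close> and \<open>y\<close> in \<open>D(T1)\<close>. On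
  \<open>x = s + (\<Sum>j. \<alpha> j *\<^sub>C t j)\<close> it therefore equals \<open>\<Sum>j. \<alpha> j * [t j, y] = - \<langle>\<Psi> x, \<Omega> y\<rangle>\<close>, and
  this is the identity stating that the operator with value \<open>(T1 y, B a - \<Omega> y)\<close> is contained
  in the adjoint. Conversely, testing membership in the domain of the adjoint only against the
  vectors \<open>(s, 0)\<close> with \<open>s\<close> in \<open>D(T0)\<close> already forces \<open>y\<close> into \<open>D(T1)\<close>. The same vectors
  together with \<open>(t j, \<xi> j)\<close> show that only zero is orthogonal to the domain of the operator
  on the direct sum, so its adjoint is single-valued.\<close>

section \<open>Sesquilinearity, orthogonality and spans\<close>

lemma cinner_add_right: "cinner x (y + z) = cinner x y + cinner x z"
  for x y z :: "'a::complex_inner"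
  by (metis cinner_add_left cinner_commute complex_cnj_add)

lemma cinner_scaleC_right: "cinner x (a *\<^sub>C y) = cnj a * cinner x y"
  for x y :: "'a::complex_inner"
  by (metis cinner_commute cinner_scaleC_left complex_cnj_mult)

lemma cinner_zero_left [simp]: "cinner 0 x = 0" for x :: "'a::complex_inner"
  using cinner_add_left[of 0 0 x] by simp

lemma cinner_zero_right [simp]: "cinner x 0 = 0" for x :: "'a::complex_inner"
  using cinner_add_right[of x 0 0] by simp

lemma cinner_diff_left: "cinner (x - y) z = cinner x z - cinner y z"
  for x y z :: "'a::complex_inner"
  using cinner_add_left[of "x - y" y z] by simp

lemma cinner_diff_right: "cinner x (y - z) = cinner x y - cinner x z"
  for x y z :: "'a::complex_inner"
  using cinner_add_right[of x "y - z" z] by simp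

lemma cinner_sum_left: "cinner (\<Sum>i\<in>I. f i) x = (\<Sum>i\<in>I. cinner (f i) x)"
  for x :: "'a::complex_inner"
  by (induction I rule: infinite_finite_induct) (simp_all add: cinner_add_left)

lemma cinner_sum_right: "cinner x (\<Sum>i\<in>I. f i) = (\<Sum>i\<in>I. cinner x (f i))"
  for x :: "'a::complex_inner"
  by (induction I rule: infinite_finite_induct) (simp_all add: cinner_add_right)

lemma cinner_self_eq_0_iff [simp]: "cinner x x = 0 \<longleftrightarrow> x = 0" for x :: "'a::complex_inner"
  by (simp add: norm_cinner)

text \<open>Pythagoras: the squared norm of \<open>x - z\<close> is the sum of the squared norms of
  \<open>x\<close> and \<open>z\<close>. This bound lets density arguments run without continuity of
  the inner product.\<close>

lemma norm_le_dist_orthogonal: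
  fixes x z :: "'a::complex_inner"
  assumes "cinner x z = 0"
  shows "norm z \<le> norm (x - z)"
proof -
  have "cinner z x = 0"
    using assms cinner_commute[of z x] by simp
  then have "cinner (x - z) (x - z) = cinner x x + cinner z z"
    using assms by (simp add: cinner_diff_left cinner_diff_right)
  then have "complex_of_real ((norm (x - z))\<^sup>2) = complex_of_real ((norm x)\<^sup>2 + (norm z)\<^sup>2)"
    by (simp only: norm_cinner of_real_add)
  then have "(norm (x - z))\<^sup>2 = (norm x)\<^sup>2 + (norm z)\<^sup>2"
    by (simp only: of_real_eq_iff)
  then have "(norm z)\<^sup>2 \<le> (norm (x - z))\<^sup>2"
    by simp
  then show ?thesis
    by (rule power2_le_imp_le) simp
qed

text \<open>A nonzero \<open>z\<close> would have some \<open>x\<close> in \<open>D\<close> closer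
  to it than \<open>norm z\<close>, which the Pythagorean bound excludes for \<open>x\<close>
  orthogonal to \<open>z\<close>.\<close>

lemma orthogonal_dense_eq_0:
  fixes z :: "'a::complex_inner"
  assumes "closure D = UNIV" and "\<And>x. x \<in> D \<Longrightarrow> cinner x z = 0"
  shows "z = 0"
proof (rule ccontr)
  assume "z \<noteq> 0"
  moreover have "z \<in> closure D"
    using assms(1) by simp
  ultimately obtain x where "x \<in> D" "norm (x - z) < norm z"
    unfolding closure_approachable dist_norm zero_less_norm_iff[symmetric] by blast
  then show False
    using norm_le_dist_orthogonal[OF assms(2)[OF \<open>x \<in> D\<close>]] by linarith
qed

text \<open>The vectors orthogonal to \<open>z\<close> form a subspace containing \<open>S\<close>,
  hence the whole space, and so \<open>z\<close> itself.\<close>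

lemma orthogonal_cspan_eq_0:
  fixes z :: "'a::complex_inner"
  assumes "cspan S = UNIV" and "\<And>x. x \<in> S \<Longrightarrow> cinner x z = 0"
  shows "z = 0"
proof -
  have "csubspace {x. cinner x z = 0}"
    by (simp add: complex_vector.subspace_def cinner_add_left cinner_scaleC_left)
  moreover have "S \<subseteq> {x. cinner x z = 0}"
    using assms(2) by blast
  ultimately have "cspan S \<subseteq> {x. cinner x z = 0}"
    by (intro complex_vector.span_minimal)
  then have "cinner z z = 0"
    unfolding assms(1) by blast
  then show ?thesis
    by simp
qed

text \<open>Coefficients are attached to indices rather than to vectors, so the family
  \<open>t\<close> may have repetitions.\<close>

lemma cspan_image_sum:
  fixes t :: "'i \<Rightarrow> 'a::complex_vector"
  assumes "finite I"
  shows "cspan (t ` I) = {\<Sum>j\<in>I. \<alpha> j *\<^sub>C t j | \<alpha>. True}" (is "_ = ?S")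
proof
  have "csubspace ?S"
    unfolding complex_vector.subspace_def
  proof (intro conjI ballI allI)
    show "0 \<in> ?S"
      by (intro CollectI exI[of _ "\<lambda>_. 0"] conjI TrueI) simp
  next
    fix x y assume "x \<in> ?S" "y \<in> ?S"
    then obtain \<alpha> \<beta> where "x = (\<Sum>j\<in>I. \<alpha> j *\<^sub>C t j)" "y = (\<Sum>j\<in>I. \<beta> j *\<^sub>C t j)"
      by blast
    then have "x + y = (\<Sum>j\<in>I. (\<alpha> j + \<beta> j) *\<^sub>C t j)"
      by (simp add: scaleC_add_left sum.distrib)
    then show "x + y \<in> ?S"
      by (intro CollectI exI[of _ "\<lambda>j. \<alpha> j + \<beta> j"] conjI TrueI)
  next
    fix c x assume "x \<in> ?S"
    then obtain \<alpha> where "x = (\<Sum>j\<in>I. \<alpha> j *\<^sub>C t j)"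
      by blast
    then have "c *\<^sub>C x = (\<Sum>j\<in>I. (c * \<alpha> j) *\<^sub>C t j)"
      by (simp add: complex_vector.scale_sum_right scaleC_scaleC)
    then show "c *\<^sub>C x \<in> ?S"
      by (intro CollectI exI[of _ "\<lambda>j. c * \<alpha> j"] conjI TrueI)
  qed
  moreover have "t i \<in> ?S" if "i \<in> I" for i
  proof -
    have "(\<Sum>j\<in>I. (if j = i then 1 else 0) *\<^sub>C t j) = (\<Sum>j\<in>I. if j = i then t j else 0)"
      by (intro sum.cong) (auto simp: scaleC_one)
    also have "\<dots> = t i"
      using assms that by simp
    finally have "t i = (\<Sum>j\<in>I. (if j = i then 1 else 0) *\<^sub>C t j)"
      by (rule sym)
    then show ?thesis
      by (intro CollectI exI[of _ "\<lambda>j. if j = i then 1 else 0"] conjI TrueI)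
  qed
  ultimately show "cspan (t ` I) \<subseteq> ?S"
    by (intro complex_vector.span_minimal) auto
  show "?S \<subseteq> cspan (t ` I)"
    by (auto intro: complex_vector.span_sum complex_vector.span_scale complex_vector.span_base)
qed

section \<open>Adjoints of operators\<close>

text \<open>Two candidates for the value differ by a vector orthogonal to the domain, so
  \<open>total\<close> makes the description unique. Asking for this instead of density covers
  \<open>hatT0\<close> by a purely algebraic check.\<close>

lemma adjoint_op_eq_SomeI:
  assumes "\<And>x. x \<in> dom T \<Longrightarrow> cinner (T \<cdot> x) y = cinner x z"
    and total: "\<And>w. (\<And>x. x \<in> dom T \<Longrightarrow> cinner x w = 0) \<Longrightarrow> w = 0"
  shows "adjoint_op T y = Some z"
proof -
  have "z' = z" if "\<forall>x\<in>dom T. cinner (T \<cdot> x) y = cinner x z'" for z'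
    using total[of "z' - z"] that assms(1) by (simp add: cinner_diff_right)
  then have "(THE z. \<forall>x\<in>dom T. cinner (T \<cdot> x) y = cinner x z) = z"
    using assms(1) by (intro the_equality) auto
  then show ?thesis
    using assms(1) by (auto simp: adjoint_op_def)
qed

lemma cinner_adjoint_op:
  assumes "densely_defined T" and "y \<in> dom (adjoint_op T)" and "x \<in> dom T"
  shows "cinner (T \<cdot> x) y = cinner x (adjoint_op T \<cdot> y)"
proof -
  obtain z where z: "\<forall>x\<in>dom T. cinner (T \<cdot> x) y = cinner x z"
    using assms(2) unfolding adjoint_op_def dom_def by force
  then have "adjoint_op T y = Some z"
    using assms(1) orthogonal_dense_eq_0[of "dom T"]
    by (intro adjoint_op_eq_SomeI) (auto simp: densely_defined_def)
  then show ?thesis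
    using z assms(3) by (simp add: op_app_def)
qed

lemma linear_operator_adjoint_op:
  assumes "densely_defined T"
  shows "linear_operator (adjoint_op T)"
proof -
  \<comment> \<open>Since density makes the value unique, each linearity law reduces to verifying
    the defining identity for the expected value.\<close>
  have Some: "adjoint_op T y = Some z"
    if "\<And>x. x \<in> dom T \<Longrightarrow> cinner (T \<cdot> x) y = cinner x z" for y z
    using that assms orthogonal_dense_eq_0[of "dom T"]
    by (intro adjoint_op_eq_SomeI) (auto simp: densely_defined_def)
  have zero: "adjoint_op T 0 = Some 0"
    by (rule Some) simp
  have add: "adjoint_op T (x + y) = Some (adjoint_op T \<cdot> x + adjoint_op T \<cdot> y)"
    if "x \<in> dom (adjoint_op T)" "y \<in> dom (adjoint_op T)" for x y
    using that assms by (intro Some) (simp add: cinner_add_right cinner_adjoint_op)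
  have scale: "adjoint_op T (a *\<^sub>C x) = Some (a *\<^sub>C (adjoint_op T \<cdot> x))"
    if "x \<in> dom (adjoint_op T)" for a x
    using that assms by (intro Some) (simp add: cinner_scaleC_right cinner_adjoint_op)
  show ?thesis
    unfolding linear_operator_def complex_vector.subspace_def
  proof (intro conjI ballI allI)
    show "0 \<in> dom (adjoint_op T)"
      using zero by (rule domI)
    show "x + y \<in> dom (adjoint_op T)"
      if "x \<in> dom (adjoint_op T)" "y \<in> dom (adjoint_op T)" for x y
      using add[OF that] by (rule domI)
    show "a *\<^sub>C x \<in> dom (adjoint_op T)" if "x \<in> dom (adjoint_op T)" for a x
      using scale[OF that] by (rule domI)
    show "adjoint_op T \<cdot> (x + y) = adjoint_op T \<cdot> x + adjoint_op T \<cdot> y"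
      if "x \<in> dom (adjoint_op T)" "y \<in> dom (adjoint_op T)" for x y
      unfolding op_app_def[of _ "x + y"] by (simp add: add[OF that])
    show "adjoint_op T \<cdot> (a *\<^sub>C x) = a *\<^sub>C (adjoint_op T \<cdot> x)"
      if "x \<in> dom (adjoint_op T)" for a x
      unfolding op_app_def[of _ "a *\<^sub>C x"] by (simp add: scale[OF that])
  qed
qed

lemma adjoint_op_symmetric_operator:
  assumes "symmetric_operator T" and "x \<in> dom T"
  shows "adjoint_op T x = Some (T \<cdot> x)"
  using assms orthogonal_dense_eq_0[of "dom T"]
  by (intro adjoint_op_eq_SomeI) (auto simp: symmetric_operator_def densely_defined_def)

section \<open>The boundary form\<close>

lemma boundary_form_commute: "boundary_form T x y = - cnj (boundary_form T y x)"
  unfolding boundary_form_def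
  using cinner_commute[of "T \<cdot> x" y] cinner_commute[of x "T \<cdot> y"] by simp

lemma boundary_form_add_left:
  assumes "linear_operator T" and "x \<in> dom T" and "y \<in> dom T"
  shows "boundary_form T (x + y) z = boundary_form T x z + boundary_form T y z"
  using assms by (simp add: boundary_form_def linear_operator_def cinner_add_left)

lemma boundary_form_sum_left:
  assumes "linear_operator T" and "finite I" and "\<And>j. j \<in> I \<Longrightarrow> t j \<in> dom T"
  shows "boundary_form T (\<Sum>j\<in>I. \<alpha> j *\<^sub>C t j) z = (\<Sum>j\<in>I. \<alpha> j * boundary_form T (t j) z)"
  using assms(2,3)
proof (induction I rule: finite_induct)
  case empty
  \<comment> \<open>Homogeneity with scalar 0 gives that \<open>T\<close> maps 0 to 0, which settles
    the empty sum.\<close>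
  have "0 \<in> dom T" "T \<cdot> (0 *\<^sub>C 0) = 0 *\<^sub>C (T \<cdot> 0)"
    using assms(1) unfolding linear_operator_def complex_vector.subspace_def by blast+
  then show ?case
    by (simp add: boundary_form_def)
next
  case (insert i I)
  have S: "csubspace (dom T)"
    using assms(1) by (simp add: linear_operator_def)
  have "\<alpha> i *\<^sub>C t i \<in> dom T"
    using S insert.prems by (intro complex_vector.subspace_scale) simp_all
  moreover have "(\<Sum>j\<in>I. \<alpha> j *\<^sub>C t j) \<in> dom T"
    using S insert.prems
    by (intro complex_vector.subspace_sum complex_vector.subspace_scale) simp_all
  moreover have "boundary_form T (\<alpha> i *\<^sub>C t i) z = \<alpha> i * boundary_form T (t i) z"
    using assms(1) insert.prems
    by (simp add: boundary_form_def linear_operator_def cinner_scaleC_left right_diff_distrib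
        del: domIff)
  ultimately show ?case
    using insert assms(1) by (simp add: boundary_form_add_left del: domIff)
qed

text \<open>By symmetry the adjoint extends \<open>T\<close>, so the two terms of the form are the
  two sides of the defining identity of the adjoint.\<close>

lemma boundary_form_symmetric_operator:
  assumes "symmetric_operator T" and "x \<in> dom T" and "y \<in> dom (adjoint_op T)"
  shows "boundary_form (adjoint_op T) x y = 0"
  using assms cinner_adjoint_op[of T y x] adjoint_op_symmetric_operator[of T x]
  by (simp add: boundary_form_def symmetric_operator_def op_app_def[of "adjoint_op T" x])

section \<open>The map \<open>Psi\<close>, the domain of \<open>hatT0\<close> and the pairing with
  \<open>Omega\<close>\<close>

lemma mem_Delta0_iff:
  "x \<in> Delta0 T0 n t \<longleftrightarrow> (\<exists>s\<in>dom T0. \<exists>\<alpha>. x = s + (\<Sum>j=1..n. \<alpha> j *\<^sub>C t j))"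
  unfolding Delta0_def by (auto simp: cspan_image_sum)

text \<open>Subtracting two representations of the same vector leaves a combination of the
  \<open>t j\<close> inside \<open>dom T0\<close>; independence modulo \<open>dom T0\<close> forces
  the coefficients to agree, so \<open>Psi\<close> is well defined.\<close>

lemma Psi_eq:
  assumes "csubspace (dom T0)" and "partial_GKN_set T0 n t" and "s \<in> dom T0"
  shows "Psi T0 n t \<xi> (s + (\<Sum>j=1..n. \<alpha> j *\<^sub>C t j)) = (\<Sum>j=1..n. \<alpha> j *\<^sub>C \<xi> j)"
  unfolding Psi_def
proof (rule the_equality)
  fix w
  assume "\<exists>s' \<beta>. s' \<in> dom T0 \<and>
    s + (\<Sum>j=1..n. \<alpha> j *\<^sub>C t j) = s' + (\<Sum>j=1..n. \<beta> j *\<^sub>C t j) \<and> w = (\<Sum>j=1..n. \<beta> j *\<^sub>C \<xi> j)"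
  then obtain s' \<beta> where s': "s' \<in> dom T0" and
    eq: "s + (\<Sum>j=1..n. \<alpha> j *\<^sub>C t j) = s' + (\<Sum>j=1..n. \<beta> j *\<^sub>C t j)" and
    w: "w = (\<Sum>j=1..n. \<beta> j *\<^sub>C \<xi> j)"
    by blast
  have "(\<Sum>j=1..n. (\<alpha> j - \<beta> j) *\<^sub>C t j) = s' - s"
    using eq by (simp add: complex_vector.scale_left_diff_distrib sum_subtractf algebra_simps)
  then have "(\<Sum>j=1..n. (\<alpha> j - \<beta> j) *\<^sub>C t j) \<in> dom T0"
    using assms(1,3) s' complex_vector.subspace_diff by metis
  then have "\<forall>j\<in>{1..n}. \<alpha> j - \<beta> j = 0"
    using assms(2)[unfolded partial_GKN_set_def, THEN conjunct2, THEN conjunct1, rule_format,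
        of "\<lambda>j. \<alpha> j - \<beta> j"]
    by simp
  then show "w = (\<Sum>j=1..n. \<alpha> j *\<^sub>C \<xi> j)"
    unfolding w by (intro sum.cong) auto
qed (use assms(3) in blast)

text \<open>Eliminates \<open>Psi\<close>: the domain is parametrized freely by \<open>s\<close> and
  the coefficients, which can then be varied separately.\<close>

lemma mem_dom_hatT0_iff:
  assumes "csubspace (dom T0)" and "partial_GKN_set T0 n t"
  shows "p \<in> dom (hatT0 T0 n t \<xi> B) \<longleftrightarrow>
    (\<exists>s\<in>dom T0. \<exists>\<alpha>. p = (s + (\<Sum>j=1..n. \<alpha> j *\<^sub>C t j), \<Sum>j=1..n. \<alpha> j *\<^sub>C \<xi> j))"
proof -
  obtain x a where p: "p = (x, a)"
    by fastforce
  have "p \<in> dom (hatT0 T0 n t \<xi> B) \<longleftrightarrow> x \<in> Delta0 T0 n t \<and> a = Psi T0 n t \<xi> x"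
    by (simp add: p hatT0_def domIff)
  also have "\<dots> \<longleftrightarrow> (\<exists>s\<in>dom T0. \<exists>\<alpha>. x = s + (\<Sum>j=1..n. \<alpha> j *\<^sub>C t j) \<and> a = Psi T0 n t \<xi> x)"
    unfolding mem_Delta0_iff by blast
  also have "\<dots> \<longleftrightarrow>
      (\<exists>s\<in>dom T0. \<exists>\<alpha>. x = s + (\<Sum>j=1..n. \<alpha> j *\<^sub>C t j) \<and> a = (\<Sum>j=1..n. \<alpha> j *\<^sub>C \<xi> j))"
    by (intro bex_cong ex_cong1 refl conj_cong) (simp add: Psi_eq[OF assms] del: One_nat_def)
  finally show ?thesis
    unfolding p prod.inject .
qed

lemma hatT0_app:
  assumes "(x, a) \<in> dom (hatT0 T0 n t \<xi> B)"
  shows "hatT0 T0 n t \<xi> B \<cdot> (x, a) = (adjoint_op T0 \<cdot> x, B a)"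
  using assms by (auto simp: hatT0_def op_app_def split: if_splits)

lemma orthogonal_dom_hatT0_eq_0:
  assumes "linear_operator T0" and "densely_defined T0" and "partial_GKN_set T0 n t"
    and "cspan (\<xi> ` {1..n}) = UNIV"
    and orth: "\<And>p. p \<in> dom (hatT0 T0 n t \<xi> B) \<Longrightarrow> cinner p q = 0"
  shows "q = 0"
proof -
  have S: "csubspace (dom T0)"
    using assms(1) by (simp add: linear_operator_def)
  have eq0: "cinner (s + (\<Sum>j=1..n. \<alpha> j *\<^sub>C t j)) (fst q) + cinner (\<Sum>j=1..n. \<alpha> j *\<^sub>C \<xi> j) (snd q) = 0"
    if "s \<in> dom T0" for s \<alpha>
  proof -
    have "(s + (\<Sum>j=1..n. \<alpha> j *\<^sub>C t j), \<Sum>j=1..n. \<alpha> j *\<^sub>C \<xi> j) \<in> dom (hatT0 T0 n t \<xi> B)"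
      unfolding mem_dom_hatT0_iff[OF S assms(3)] using that by blast
    from orth[OF this] show ?thesis
      by (simp add: cinner_prod_def)
  qed
  \<comment> \<open>Zero coefficients isolate the first component.\<close>
  have "cinner s (fst q) = 0" if "s \<in> dom T0" for s
    using eq0[OF that, of "\<lambda>_. 0"] by simp
  then have fst: "fst q = 0"
    using assms(2) unfolding densely_defined_def by (rule orthogonal_dense_eq_0[rotated])
  \<comment> \<open>With \<open>fst q = 0\<close> known, taking \<open>s = 0\<close> leaves only the
    pairing in W, where the coefficients are arbitrary.\<close>
  have "cinner x (snd q) = 0" if "x \<in> \<xi> ` {1..n}" for x
  proof -
    have "x \<in> cspan (\<xi> ` {1..n})"
      using that by (rule complex_vector.span_base)
    then obtain \<alpha> where "x = (\<Sum>j=1..n. \<alpha> j *\<^sub>C \<xi> j)"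
      by (auto simp: cspan_image_sum)
    then show ?thesis
      using eq0[OF complex_vector.subspace_0[OF S], of \<alpha>] fst by simp
  qed
  then have "snd q = 0"
    using assms(4) by (rule orthogonal_cspan_eq_0[rotated])
  with fst show ?thesis
    by (simp add: prod_eq_iff)
qed

text \<open>The sign comes from the order of arguments in \<open>Omega\<close>: pairing with
  \<open>\<xi> j\<close> extracts the conjugate of the coefficient [y, t j], and by skew-Hermitian
  symmetry this conjugate is -[t j, y].\<close>

lemma boundary_form_eq_Omega:
  assumes "symmetric_operator T0" and "partial_GKN_set T0 n t" and "orthonormal_basis n \<xi>"
    and "s \<in> dom T0" and "y \<in> dom (adjoint_op T0)"
  shows "boundary_form (adjoint_op T0) (s + (\<Sum>j=1..n. \<alpha> j *\<^sub>C t j)) y =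
    - cinner (\<Sum>j=1..n. \<alpha> j *\<^sub>C \<xi> j) (Omega (adjoint_op T0) n t \<xi> y)"
proof -
  let ?T1 = "adjoint_op T0"
  have lin: "linear_operator ?T1"
    using assms(1) by (intro linear_operator_adjoint_op) (simp add: symmetric_operator_def)
  have t: "t j \<in> dom ?T1" if "j \<in> {1..n}" for j
    using assms(2) that by (simp add: partial_GKN_set_def)
  have s: "s \<in> dom ?T1"
    using adjoint_op_symmetric_operator[OF assms(1,4)] by (rule domI)
  have u: "(\<Sum>j=1..n. \<alpha> j *\<^sub>C t j) \<in> dom ?T1"
  proof (intro complex_vector.subspace_sum complex_vector.subspace_scale)
    show "csubspace (dom ?T1)"
      using lin by (simp add: linear_operator_def)
    then show "csubspace (dom ?T1)" .
  qed (rule t)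
  have \<xi>: "cinner (\<xi> j) (Omega ?T1 n t \<xi> y) = cnj (boundary_form ?T1 y (t j))"
    if "j \<in> {1..n}" for j
  proof -
    have "cinner (\<xi> j) (Omega ?T1 n t \<xi> y) =
        (\<Sum>i=1..n. cnj (boundary_form ?T1 y (t i)) * cinner (\<xi> j) (\<xi> i))"
      by (simp add: Omega_def cinner_sum_right cinner_scaleC_right)
    also have "\<dots> = (\<Sum>i=1..n. if i = j then cnj (boundary_form ?T1 y (t i)) else 0)"
      using assms(3) that by (intro sum.cong) (auto simp: orthonormal_basis_def)
    finally show ?thesis
      using that by simp
  qed
  \<comment> \<open>The \<open>s\<close> part contributes nothing, because \<open>s\<close> lies in
    \<open>dom T0\<close> and \<open>y\<close> in the domain of the adjoint.\<close>
  have "boundary_form ?T1 (s + (\<Sum>j=1..n. \<alpha> j *\<^sub>C t j)) y =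
      (\<Sum>j=1..n. \<alpha> j * boundary_form ?T1 (t j) y)"
    unfolding boundary_form_add_left[OF lin s u]
      boundary_form_symmetric_operator[OF assms(1,4,5)] add_0_left
    by (rule boundary_form_sum_left[OF lin finite_atLeastAtMost t])
  also have "\<dots> = (\<Sum>j=1..n. - (\<alpha> j * cinner (\<xi> j) (Omega ?T1 n t \<xi> y)))"
  proof (rule sum.cong)
    fix j assume "j \<in> {1..n}"
    then have "boundary_form ?T1 (t j) y = - cinner (\<xi> j) (Omega ?T1 n t \<xi> y)"
      unfolding \<xi>[OF \<open>j \<in> {1..n}\<close>] by (intro boundary_form_commute)
    then show "\<alpha> j * boundary_form ?T1 (t j) y = - (\<alpha> j * cinner (\<xi> j) (Omega ?T1 n t \<xi> y))"
      by simp
  qed (rule refl)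
  finally show ?thesis
    by (simp add: cinner_sum_left cinner_scaleC_left sum_negf)
qed

section \<open>The adjoint on the direct sum\<close>

theorem theorem4p2:
  fixes T0 T1 :: "'h::chilbert_space operator"
    and B :: "'w::complex_inner \<Rightarrow> 'w"
    and \<xi> :: "nat \<Rightarrow> 'w" and t :: "nat \<Rightarrow> 'h" and n d :: nat
  assumes "closed_operator T0" and "symmetric_operator T0"
    and "finite_deficiency_indices T0 d" and "d \<ge> 1"
    and "T1 = adjoint_op T0"
    and "cfinite_dim (UNIV :: 'w set)" and "n = cdim (UNIV :: 'w set)" and "n \<le> d"
    and "orthonormal_basis n \<xi>"
    and "partial_GKN_set T0 n t"
    and "selfadjoint B"
  shows "adjoint_op (hatT0 T0 n t \<xi> B) = hatT1 T1 n t \<xi> B"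
proof
  fix q :: "'h \<times> 'w"
  obtain y b where q: "q = (y, b)"
    by fastforce
  have lin: "linear_operator T0" and dense: "densely_defined T0"
    using assms(2) by (simp_all add: symmetric_operator_def)
  then have S: "csubspace (dom T0)"
    by (simp add: linear_operator_def)
  have span: "cspan (\<xi> ` {1..n}) = UNIV"
    using assms(9) by (simp add: orthonormal_basis_def)
  note dom_iff = mem_dom_hatT0_iff[OF S assms(10), of _ \<xi> B]
  \<comment> \<open>Whether \<open>hatT1\<close> is defined at \<open>(y, b)\<close> depends on
    \<open>y\<close> alone, so the case split does not involve \<open>b\<close>.\<close>
  show "adjoint_op (hatT0 T0 n t \<xi> B) q = hatT1 T1 n t \<xi> B q"
  proof (cases "y \<in> dom T1")
    case True
    have "adjoint_op (hatT0 T0 n t \<xi> B) q = Some (T1 \<cdot> y, B b - Omega T1 n t \<xi> y)"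
    proof (rule adjoint_op_eq_SomeI)
      fix p assume p: "p \<in> dom (hatT0 T0 n t \<xi> B)"
      then obtain s \<alpha> where s: "s \<in> dom T0"
        and p_eq: "p = (s + (\<Sum>j=1..n. \<alpha> j *\<^sub>C t j), \<Sum>j=1..n. \<alpha> j *\<^sub>C \<xi> j)"
        unfolding dom_iff by blast
      have "boundary_form T1 (fst p) y = - cinner (snd p) (Omega T1 n t \<xi> y)"
        using boundary_form_eq_Omega[OF assms(2,10,9) s] True by (simp add: p_eq assms(5))
      moreover have "cinner (B (snd p)) b = cinner (snd p) (B b)"
        using assms(11) by (simp add: selfadjoint_def)
      moreover have "hatT0 T0 n t \<xi> B \<cdot> p = (T1 \<cdot> fst p, B (snd p))"
        using hatT0_app[of "fst p" "snd p"] p by (simp add: assms(5))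
      \<comment> \<open>Writing p = (x, a), the left side is <x, T1 y> + [x, y] + <a, B b>, and
        [x, y] = -<a, Omega y> is absorbed into the second component.\<close>
      ultimately show "cinner (hatT0 T0 n t \<xi> B \<cdot> p) q = cinner p (T1 \<cdot> y, B b - Omega T1 n t \<xi> y)"
        by (simp add: q cinner_prod_def boundary_form_def cinner_diff_right algebra_simps)
    qed (rule orthogonal_dom_hatT0_eq_0[OF lin dense assms(10) span])
    then show ?thesis
      using True by (simp add: q hatT1_def)
  next
    case False
    have "\<nexists>z. \<forall>p\<in>dom (hatT0 T0 n t \<xi> B). cinner (hatT0 T0 n t \<xi> B \<cdot> p) q = cinner p z"
    proof
      assume "\<exists>z. \<forall>p\<in>dom (hatT0 T0 n t \<xi> B). cinner (hatT0 T0 n t \<xi> B \<cdot> p) q = cinner p z"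
      then obtain z
        where z: "\<forall>p\<in>dom (hatT0 T0 n t \<xi> B). cinner (hatT0 T0 n t \<xi> B \<cdot> p) q = cinner p z"
        by blast
      \<comment> \<open>Needed so that the test vectors \<open>(s, 0)\<close> contribute nothing in
        W. Self-adjointness gives <B 0, B 0> = <0, B (B 0)> = 0.\<close>
      have "B 0 = 0"
      proof -
        have "cinner (B 0) (B 0) = cinner 0 (B (B 0))"
          using assms(11) unfolding selfadjoint_def by blast
        then show ?thesis
          by simp
      qed
      \<comment> \<open>Restricted to the vectors \<open>(s, 0)\<close>, the identity for
        \<open>z\<close> becomes the adjoint identity for \<open>T0\<close>, with
        \<open>fst z\<close> as the witness that puts \<open>y\<close> into
        \<open>dom T1\<close>.\<close>
      have "cinner (T0 \<cdot> s) y = cinner s (fst z)" if s: "s \<in> dom T0" for s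
      proof -
        have mem: "(s, 0) \<in> dom (hatT0 T0 n t \<xi> B)"
          unfolding dom_iff using s by (intro bexI[of _ s] exI[of _ "\<lambda>_. 0"]) simp_all
        have "T1 \<cdot> s = T0 \<cdot> s"
          using adjoint_op_symmetric_operator[OF assms(2) s]
          by (simp add: assms(5) op_app_def[of "adjoint_op T0"])
        then show ?thesis
          using bspec[OF z mem] hatT0_app[OF mem] \<open>B 0 = 0\<close>
          by (simp add: q cinner_prod_def assms(5))
      qed
      then have "y \<in> dom T1"
        by (auto simp: assms(5) adjoint_op_def)
      then show False
        using False by blast
    qed
    then have "adjoint_op (hatT0 T0 n t \<xi> B) q = None"
      by (simp add: adjoint_op_def)
    moreover have "hatT1 T1 n t \<xi> B q = None"
      using False by (simp add: q hatT1_def)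
    ultimately show ?thesis
      by simp
  qed
qed

end
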